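(* Let $\mathcal H$ be a real Hilbert space, let $\mu\in\,]0,\infty[$, let $n\ge 1$ be an integer, $I=\{1,\dots,n\}$, and let $\lambda_i>0$ ($i\in I$) satisfy $\sum_{i\in I}\lambda_i=1$. For each $i\in I$ let $A_i:\mathcal H\rightrightarrows\mathcal H$ be maximally monotone, and write $\mathbf A=(A_1,\dots,A_n)$, $\boldsymbol\lambda=(\lambda_1,\dots,\lambda_n)$. If there exists $i_0\in I$ such that $A_{i_0}$ is at most single-valued, then $\mathcal R_\mu(\mathbf A,\boldsymbol\lambda)$ is at most single-valued.
   Context: A mapping $A:\mathcal H\rightrightarrows\mathcal H$ is at most single-valued if for every $x\in\mathcal H$ the set $Ax$ is either empty or a singleton. $A^{-1}$ is the set-valued mapping with $x\in A^{-1}u\Leftrightarrow u\in Ax$. Sums and scalar multiples of set-valued mappings are pointwise Minkowski operations; $\mathrm{Id}$ is the identity. The $\boldsymbol\lambda$-weighted resolvent average of $\mathbf A$ with parameter $\mu$ is the set-valued mapping $$\mathcal R_\mu(\mathbf A,\boldsymbol\lambda)=\Big(\sum_{i\in I}\lambda_i(A_i+\mu^{-1}\mathrm{Id})^{-1}\Big)^{-1}-\mu^{-1}\mathrm{Id}.$$ *)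

theory Defs
  imports "HOL-Analysis.Analysis" "HOL-Library.Set_Algebras"
begin

type_synonym 'a svmap = "'a \<Rightarrow> 'a set"

definition gra :: "'a svmap \<Rightarrow> ('a \<times> 'a) set" where
  "gra A = {(x, u). u \<in> A x}"

definition sv_monotone :: "'a::real_inner svmap \<Rightarrow> bool" where
  "sv_monotone A \<longleftrightarrow>
     (\<forall>(x, u) \<in> gra A. \<forall>(y, v) \<in> gra A. 0 \<le> (x - y) \<bullet> (u - v))"

definition maximally_monotone :: "'a::real_inner svmap \<Rightarrow> bool" where
  "maximally_monotone A \<longleftrightarrow>
     sv_monotone A \<and> (\<nexists>B. sv_monotone B \<and> gra A \<subset> gra B)"

definition at_most_single_valued :: "'a svmap \<Rightarrow> bool" where
  "at_most_single_valued A \<longleftrightarrow> (\<forall>x. A x = {} \<or> is_singleton (A x))"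

definition sv_inverse :: "'a svmap \<Rightarrow> 'a svmap" where
  "sv_inverse A = (\<lambda>u. {x. u \<in> A x})"

definition sv_Id :: "'a svmap" where
  "sv_Id = (\<lambda>x. {x})"

text \<open>
  On sets, \<open>+\<close> and \<open>\<Sum>\<close> are the Minkowski operations of \<^theory>\<open>HOL-Library.Set_Algebras\<close>, with
  neutral element \<open>{0}\<close>. Since \<open>-\<close> on sets is set difference, differences of mappings
  are written by adding a negative multiple.
\<close>

definition sv_add :: "'a::real_vector svmap \<Rightarrow> 'a svmap \<Rightarrow> 'a svmap" where
  "sv_add A B = (\<lambda>x. A x + B x)"

definition sv_scale :: "real \<Rightarrow> 'a::real_vector svmap \<Rightarrow> 'a svmap" where
  "sv_scale c A = (\<lambda>x. (*\<^sub>R) c ` A x)"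

definition sv_sum :: "('i \<Rightarrow> 'a::real_vector svmap) \<Rightarrow> 'i set \<Rightarrow> 'a svmap" where
  "sv_sum F I = (\<lambda>x. \<Sum>i\<in>I. F i x)"

definition resolvent_average ::
  "real \<Rightarrow> 'i set \<Rightarrow> ('i \<Rightarrow> 'a::real_vector svmap) \<Rightarrow> ('i \<Rightarrow> real) \<Rightarrow> 'a svmap" where
  "resolvent_average \<mu> I A lam =
     sv_add
       (sv_inverse
         (sv_sum (\<lambda>i. sv_scale (lam i) (sv_inverse (sv_add (A i) (sv_scale (inverse \<mu>) sv_Id)))) I))
       (sv_scale (- inverse \<mu>) sv_Id)"

end

theory Submission
  imports Defs
begin

text \<open>
  Put \<open>T\<^sub>i = (A\<^sub>i + \<mu>\<inverse> Id)\<inverse>\<close>. Monotonicity of \<open>A\<^sub>i\<close> makes \<open>T\<^sub>i\<close> cocoercive: if \<open>x \<in> T\<^sub>i u\<close> and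
  \<open>y \<in> T\<^sub>i v\<close>, then \<open>\<mu>\<inverse> \<parallel>x - y\<parallel>\<^sup>2 \<le> \<langle>x - y, u - v\<rangle>\<close>. Two values of the resolvent average at a common
  point correspond to \<open>u\<close>, \<open>v\<close> and selections \<open>x\<^sub>i \<in> T\<^sub>i u\<close>, \<open>y\<^sub>i \<in> T\<^sub>i v\<close> with
  \<open>\<Sum>\<^sub>i \<lambda>\<^sub>i x\<^sub>i = \<Sum>\<^sub>i \<lambda>\<^sub>i y\<^sub>i\<close>. Averaging the cocoercivity inequalities gives
  \<open>\<mu>\<inverse> \<Sum>\<^sub>i \<lambda>\<^sub>i \<parallel>x\<^sub>i - y\<^sub>i\<parallel>\<^sup>2 \<le> \<langle>\<Sum>\<^sub>i \<lambda>\<^sub>i (x\<^sub>i - y\<^sub>i), u - v\<rangle> = 0\<close>, so \<open>x\<^sub>i = y\<^sub>i\<close> for every \<open>i\<close>. For the index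
  \<open>i\<^sub>0\<close> of an at most single-valued mapping, \<open>u - \<mu>\<inverse> x\<^sub>i\<^sub>0\<close> and \<open>v - \<mu>\<inverse> x\<^sub>i\<^sub>0\<close> both lie in
  \<open>A\<^sub>i\<^sub>0 x\<^sub>i\<^sub>0\<close>, hence \<open>u = v\<close>.
\<close>

lemma at_most_single_valued_iff:
  "at_most_single_valued A \<longleftrightarrow> (\<forall>x. \<forall>u\<in>A x. \<forall>v\<in>A x. u = v)"
proof -
  have "B = {} \<or> is_singleton B \<longleftrightarrow> (\<forall>u\<in>B. \<forall>v\<in>B. u = v)" for B :: "'a set"
    by (metis empty_iff is_singletonE is_singletonI' singletonD)
  then show ?thesis
    by (simp add: at_most_single_valued_def)
qed

lemma mem_add_scaled_Id_iff:
  fixes A :: "'a::real_vector svmap"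
  shows "u \<in> sv_add A (sv_scale c sv_Id) x \<longleftrightarrow> u - c *\<^sub>R x \<in> A x"
proof
  assume "u - c *\<^sub>R x \<in> A x"
  then have "(u - c *\<^sub>R x) + c *\<^sub>R x \<in> A x + {c *\<^sub>R x}"
    by (intro set_plus_intro) auto
  then show "u \<in> sv_add A (sv_scale c sv_Id) x"
    by (simp add: sv_add_def sv_scale_def sv_Id_def)
next
  assume "u \<in> sv_add A (sv_scale c sv_Id) x"
  then have "u \<in> A x + {c *\<^sub>R x}"
    by (simp add: sv_add_def sv_scale_def sv_Id_def)
  then obtain a where "a \<in> A x" and "u = a + c *\<^sub>R x"
    by (rule set_plus_elim) simp
  then show "u - c *\<^sub>R x \<in> A x"
    by simp
qed

lemma mem_inverse_add_scaled_Id_iff: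
  fixes A :: "'a::real_vector svmap"
  shows "x \<in> sv_inverse (sv_add A (sv_scale c sv_Id)) u \<longleftrightarrow> u - c *\<^sub>R x \<in> A x"
  by (simp add: sv_inverse_def mem_add_scaled_Id_iff)

lemma mem_weighted_sumE:
  fixes F :: "'i \<Rightarrow> 'a::real_vector svmap"
  assumes "finite I" and "z \<in> sv_sum (\<lambda>i. sv_scale (lam i) (F i)) I u"
  obtains x where "\<And>i. i \<in> I \<Longrightarrow> x i \<in> F i u" and "z = (\<Sum>i\<in>I. lam i *\<^sub>R x i)"
proof -
  obtain s where z: "z = sum s I" and "\<forall>i\<in>I. s i \<in> (*\<^sub>R) (lam i) ` F i u"
    using assms by (auto simp: sv_sum_def sv_scale_def set_sum_alt)
  then have "\<forall>i\<in>I. \<exists>y. y \<in> F i u \<and> s i = lam i *\<^sub>R y"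
    by blast
  then obtain x where "\<forall>i\<in>I. x i \<in> F i u \<and> s i = lam i *\<^sub>R x i"
    by metis
  with z show thesis
    by (intro that[of x]) auto
qed

text \<open>
  Unfolding of the outer inverse and shift: \<open>w\<close> is a value at \<open>z\<close> exactly when \<open>z\<close> is a value of the
  averaged resolvents at \<open>w + \<mu>\<inverse> z\<close>. Such a value
  comes with points of the individual resolvents, so their full domain plays no role.
\<close>
lemma mem_resolvent_averageE:
  assumes "finite I" and "w \<in> resolvent_average \<mu> I A lam z"
  obtains x where "z = (\<Sum>i\<in>I. lam i *\<^sub>R x i)"
    and "\<And>i. i \<in> I \<Longrightarrow> (w + inverse \<mu> *\<^sub>R z) - inverse \<mu> *\<^sub>R x i \<in> A i (x i)"
proof -
  have "z \<in> sv_sum (\<lambda>i. sv_scale (lam i) (sv_inverse (sv_add (A i) (sv_scale (inverse \<mu>) sv_Id)))) I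
              (w + inverse \<mu> *\<^sub>R z)"
    using assms(2) by (simp add: resolvent_average_def mem_add_scaled_Id_iff) (simp add: sv_inverse_def)
  then obtain x where z: "z = (\<Sum>i\<in>I. lam i *\<^sub>R x i)"
    and "\<And>i. i \<in> I \<Longrightarrow>
      x i \<in> sv_inverse (sv_add (A i) (sv_scale (inverse \<mu>) sv_Id)) (w + inverse \<mu> *\<^sub>R z)"
    by (elim mem_weighted_sumE[OF assms(1)]) blast
  then show thesis
    by (intro that[OF z]) (simp only: mem_inverse_add_scaled_Id_iff)
qed

lemma sv_monotone_inverse_add_scaled_Id_cocoercive:
  assumes "sv_monotone A" and "u - c *\<^sub>R x \<in> A x" and "v - c *\<^sub>R y \<in> A y"
  shows "c * (norm (x - y))\<^sup>2 \<le> (x - y) \<bullet> (u - v)"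
proof -
  have "0 \<le> (x - y) \<bullet> ((u - c *\<^sub>R x) - (v - c *\<^sub>R y))"
    using assms unfolding sv_monotone_def gra_def by blast
  also have "(u - c *\<^sub>R x) - (v - c *\<^sub>R y) = (u - v) - c *\<^sub>R (x - y)"
    by (simp add: algebra_simps)
  finally show ?thesis
    by (simp add: inner_diff_right power2_norm_eq_inner)
qed

text \<open>
  The step that forces the selections to coincide: the weighted sum of the squared distances
  \<open>c * (norm (x i - y i))\<^sup>2\<close> is squeezed to \<open>0\<close>, and every weight is positive.
\<close>
lemma weighted_cocoercive_sums_eqD:
  fixes x y :: "'i \<Rightarrow> 'a::real_inner"
  assumes "finite I" and "0 < c" and lam: "\<And>i. i \<in> I \<Longrightarrow> 0 < lam i"
    and coco: "\<And>i. i \<in> I \<Longrightarrow> c * (norm (x i - y i))\<^sup>2 \<le> (x i - y i) \<bullet> d"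
    and eq: "(\<Sum>i\<in>I. lam i *\<^sub>R x i) = (\<Sum>i\<in>I. lam i *\<^sub>R y i)"
    and "i \<in> I"
  shows "x i = y i"
proof -
  have nonneg: "0 \<le> lam i * (c * (norm (x i - y i))\<^sup>2)" if "i \<in> I" for i
    using lam[OF that] \<open>0 < c\<close> by simp
  have "(\<Sum>i\<in>I. lam i * (c * (norm (x i - y i))\<^sup>2)) \<le> (\<Sum>i\<in>I. lam i * ((x i - y i) \<bullet> d))"
    by (intro sum_mono mult_left_mono coco) (auto intro: less_imp_le lam)
  also have "\<dots> = (\<Sum>i\<in>I. lam i *\<^sub>R x i - lam i *\<^sub>R y i) \<bullet> d"
    by (simp add: inner_sum_left inner_diff_left right_diff_distrib)
  also have "\<dots> = 0"
    by (simp add: sum_subtractf eq)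
  finally have "(\<Sum>i\<in>I. lam i * (c * (norm (x i - y i))\<^sup>2)) = 0"
    using nonneg by (intro antisym sum_nonneg)
  then have "lam i * (c * (norm (x i - y i))\<^sup>2) = 0"
    using sum_nonneg_eq_0_iff[of I "\<lambda>i. lam i * (c * (norm (x i - y i))\<^sup>2)"] nonneg
      \<open>finite I\<close> \<open>i \<in> I\<close> by auto
  then show ?thesis
    using lam[OF \<open>i \<in> I\<close>] \<open>0 < c\<close> by simp
qed

theorem theorem3p4:
  fixes \<mu> :: real and n :: nat and lam :: "nat \<Rightarrow> real"
    and A :: "nat \<Rightarrow> 'a::{real_inner, complete_space} \<Rightarrow> 'a set"
  assumes "0 < \<mu>" and "1 \<le> n"
    and "\<And>i. i \<in> {1..n} \<Longrightarrow> 0 < lam i"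
    and "(\<Sum>i\<in>{1..n}. lam i) = 1"
    and "\<And>i. i \<in> {1..n} \<Longrightarrow> maximally_monotone (A i)"
    and "\<exists>i0\<in>{1..n}. at_most_single_valued (A i0)"
  shows "at_most_single_valued (resolvent_average \<mu> {1..n} A lam)"
proof -
  obtain i0 where i0: "i0 \<in> {1..n}" and single: "at_most_single_valued (A i0)"
    using assms(6) by blast
  have mono: "sv_monotone (A i)" if "i \<in> {1..n}" for i
    using assms(5)[OF that] by (simp add: maximally_monotone_def)
  have "w = w'" if w: "w \<in> resolvent_average \<mu> {1..n} A lam z"
    and w': "w' \<in> resolvent_average \<mu> {1..n} A lam z" for w w' z
  proof -
    define u where "u = w + inverse \<mu> *\<^sub>R z"
    define v where "v = w' + inverse \<mu> *\<^sub>R z"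
    obtain x where zx: "z = (\<Sum>i\<in>{1..n}. lam i *\<^sub>R x i)"
      and x: "\<And>i. i \<in> {1..n} \<Longrightarrow> u - inverse \<mu> *\<^sub>R x i \<in> A i (x i)"
      unfolding u_def by (rule mem_resolvent_averageE[OF finite_atLeastAtMost w]) blast
    obtain y where zy: "z = (\<Sum>i\<in>{1..n}. lam i *\<^sub>R y i)"
      and y: "\<And>i. i \<in> {1..n} \<Longrightarrow> v - inverse \<mu> *\<^sub>R y i \<in> A i (y i)"
      unfolding v_def by (rule mem_resolvent_averageE[OF finite_atLeastAtMost w']) blast
    have "x i0 = y i0"
    proof (rule weighted_cocoercive_sums_eqD[where I = "{1..n}" and c = "inverse \<mu>" and d = "u - v"])
      show "inverse \<mu> * (norm (x i - y i))\<^sup>2 \<le> (x i - y i) \<bullet> (u - v)" if "i \<in> {1..n}" for i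
        using sv_monotone_inverse_add_scaled_Id_cocoercive[OF mono x y] that by blast
      show "(\<Sum>i\<in>{1..n}. lam i *\<^sub>R x i) = (\<Sum>i\<in>{1..n}. lam i *\<^sub>R y i)"
        by (rule trans[OF zx[symmetric] zy])
    qed (use assms(1,3) i0 in auto)
    then have "u - inverse \<mu> *\<^sub>R x i0 = v - inverse \<mu> *\<^sub>R x i0"
      using single x[OF i0] y[OF i0] unfolding at_most_single_valued_iff by metis
    then show "w = w'"
      by (simp add: u_def v_def)
  qed
  then show ?thesis
    unfolding at_most_single_valued_iff by blast
qed

end
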